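(* Let $q$ be a real constant with $0<|q/2|<1$ and let $s,\ell\in\mathbb R$, $s\neq\ell$. Put $\Delta_\pm=\sqrt{1+(q/2)^2\lambda^{\pm2}}$ and $$A_\pm=\frac1{\Delta_\pm}\begin{pmatrix}1&\pm\frac i2q\lambda^{\pm1}\\ \pm\frac i2q\lambda^{\pm1}&1\end{pmatrix},\qquad F_+(n)=\mathrm{diag}(e^{is},e^{-is})A_+^n,\quad G_-(m)=\mathrm{diag}(e^{i\ell},e^{-i\ell})A_-^m\quad(n,m\ge0,\ A_\pm^0=\mathrm{Id}).$$ Decompose $F_+(n)^{-1}G_-(m)=V_-V_+^{-1}$ with $V_-\in\Lambda^-_*\mathrm{SU}_2$, $V_+\in\Lambda^+\mathrm{SU}_2$, and set $F=F_+V_-=G_-V_+$. Then $$\lambda F^{-1}\partial_\lambda F=\frac{1}{\Delta_+^2\Delta_-^2}\begin{pmatrix}a&b\lambda^{-1}+c\lambda\\ -\bar b\lambda^{-1}-\bar c\lambda&-a\end{pmatrix},$$ where $a\in i\mathbb R$ and $b,c\in\mathbb C$ are functions of $(n,m)$ only (independent of $\lambda$).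
   Context: Pauli matrix $\sigma_3=\mathrm{diag}(1,-1)$. Loop groups: $\Lambda\mathrm{SU}_2$ is the group of maps $g$ of the spectral parameter $\lambda$ into $\mathrm{SL}_2\mathbb C$ with Wiener-algebra entries, satisfying $g(\lambda)=\big(\overline{g(\bar\lambda)}^{\,t}\big)^{-1}$ and $\sigma_3g(\lambda)\sigma_3^{-1}=g(-\lambda)$. $\Lambda^+\mathrm{SU}_2$ (resp. $\Lambda^-\mathrm{SU}_2$) consists of loops extending holomorphically to the open unit disk (resp. to $\{|\lambda|>1\}\cup\{\infty\}$); $\Lambda^-_*\mathrm{SU}_2=\{g\in\Lambda^-\mathrm{SU}_2:g(\infty)=\mathrm{Id}\}$. Birkhoff decomposition (known fact): every $g\in\Lambda\mathrm{SU}_2$ factors uniquely as $g=g_-g_+$ with $g_-\in\Lambda^-_*\mathrm{SU}_2$, $g_+\in\Lambda^+\mathrm{SU}_2$. The branches of $\Delta_\pm$ are positive for $\lambda>0$. *)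

theory Defs
  imports "HOL-Analysis.Analysis"
begin

type_synonym cmat = "complex^2^2"

abbreviation circle :: "complex set" where "circle \<equiv> sphere 0 1"

definition mat2 :: "complex \<Rightarrow> complex \<Rightarrow> complex \<Rightarrow> complex \<Rightarrow> cmat" where
  "mat2 a b c d = (\<chi> i j. if i = 1 then (if j = 1 then a else b) else (if j = 1 then c else d))"

definition smul :: "complex \<Rightarrow> cmat \<Rightarrow> cmat" where
  "smul c A = (\<chi> i j. c * A $ i $ j)"

definition ctrans :: "cmat \<Rightarrow> cmat" where
  "ctrans A = (\<chi> i j. cnj (A $ j $ i))"

fun mpow :: "cmat \<Rightarrow> nat \<Rightarrow> cmat" where
  "mpow A 0 = mat 1"
| "mpow A (Suc n) = A ** mpow A n"

definition sigma3 :: cmat where "sigma3 = mat2 1 0 0 (-1)"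

definition wiener :: "(complex \<Rightarrow> complex) \<Rightarrow> bool" where
  "wiener f \<longleftrightarrow> (\<exists>c :: int \<Rightarrow> complex. (\<lambda>k. norm (c k)) summable_on UNIV \<and>
      (\<forall>z\<in>circle. ((\<lambda>k. c k * z powi k) has_sum f z) UNIV))"

text \<open>The twisted loop group \<Lambda>SU_2 (values only matter on the unit circle).\<close>
definition LSU2 :: "(complex \<Rightarrow> cmat) set" where
  "LSU2 = {g. (\<forall>i j. wiener (\<lambda>z. g z $ i $ j)) \<and>
     (\<forall>z\<in>circle. det (g z) = 1 \<and>
        g z = matrix_inv (ctrans (g (cnj z))) \<and>
        sigma3 ** g z ** matrix_inv sigma3 = g (-z))}"

definition LSU2_plus :: "(complex \<Rightarrow> cmat) set" where
  "LSU2_plus = {g \<in> LSU2. \<exists>h :: complex \<Rightarrow> cmat.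
     (\<forall>i j. (\<lambda>z. h z $ i $ j) holomorphic_on ball 0 1 \<and>
            continuous_on (cball 0 1) (\<lambda>z. h z $ i $ j)) \<and>
     (\<forall>z\<in>circle. h z = g z)}"

text \<open>Loops extending holomorphically to {|z|>1} \<union> {\<infinity>}: expressed in the chart w = 1/z,
  i.e. k(w) = g(1/w) extends holomorphically to the open disk |w|<1 (w = 0 being \<infinity>);
  k 0 is the value g(\<infinity>).\<close>
definition ext_minus :: "(complex \<Rightarrow> cmat) \<Rightarrow> (complex \<Rightarrow> cmat) \<Rightarrow> bool" where
  "ext_minus g k \<longleftrightarrow>
     (\<forall>i j. (\<lambda>w. k w $ i $ j) holomorphic_on ball 0 1 \<and>
            continuous_on (cball 0 1) (\<lambda>w. k w $ i $ j)) \<and>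
     (\<forall>w\<in>circle. k w = g (1 / w))"

definition LSU2_minus :: "(complex \<Rightarrow> cmat) set" where
  "LSU2_minus = {g \<in> LSU2. \<exists>k. ext_minus g k}"

definition LSU2_minus_star :: "(complex \<Rightarrow> cmat) set" where
  "LSU2_minus_star = {g \<in> LSU2. \<exists>k. ext_minus g k \<and> k 0 = mat 1}"

text \<open>The data of Theorem 3.1 (principal square root; positive for z > 0).\<close>
definition Delta_plus :: "real \<Rightarrow> complex \<Rightarrow> complex" where
  "Delta_plus q z = csqrt (1 + (of_real q / 2)^2 * z^2)"

definition Delta_minus :: "real \<Rightarrow> complex \<Rightarrow> complex" where
  "Delta_minus q z = csqrt (1 + (of_real q / 2)^2 * z powi (-2))"

definition A_plus :: "real \<Rightarrow> complex \<Rightarrow> cmat" where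
  "A_plus q z = smul (1 / Delta_plus q z)
     (mat2 1 (\<i> / 2 * of_real q * z) (\<i> / 2 * of_real q * z) 1)"

definition A_minus :: "real \<Rightarrow> complex \<Rightarrow> cmat" where
  "A_minus q z = smul (1 / Delta_minus q z)
     (mat2 1 (- \<i> / 2 * of_real q * inverse z) (- \<i> / 2 * of_real q * inverse z) 1)"

definition F_plus :: "real \<Rightarrow> real \<Rightarrow> nat \<Rightarrow> complex \<Rightarrow> cmat" where
  "F_plus q s n z = mat2 (exp (\<i> * of_real s)) 0 0 (exp (- \<i> * of_real s)) ** mpow (A_plus q z) n"

definition G_minus :: "real \<Rightarrow> real \<Rightarrow> nat \<Rightarrow> complex \<Rightarrow> cmat" where
  "G_minus q l m z = mat2 (exp (\<i> * of_real l)) 0 0 (exp (- \<i> * of_real l)) ** mpow (A_minus q z) m"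

end

theory Submission
  imports Defs "HOL-Complex_Analysis.Conformal_Mappings"
begin

text \<open>
  Write \<open>L = adj F \<cdot> F'\<close>, which is \<open>F\<inverse> F'\<close> on the circle since \<open>det F = 1\<close>. From
  \<open>F = F\<^sub>+ V\<^sub>-\<close> the cleared expression \<open>\<lambda>\<^sup>2 \<Delta>\<^sub>+\<^sup>2 \<Delta>\<^sub>-\<^sup>2 L\<close> extends holomorphically to \<open>|\<lambda>| > 1\<close> with
  growth \<open>O(\<lambda>\<^sup>2)\<close>, and from \<open>F = G\<^sub>- V\<^sub>+\<close> it extends holomorphically to \<open>|\<lambda>| < 1\<close>: the only
  singularities of \<open>F\<^sub>+\<inverse> F\<^sub>+' = n (i q/2) \<Delta>\<^sub>+\<^sup>-\<^sup>2 \<sigma>\<^sub>1\<close> and of its counterpart for \<open>G\<^sub>-\<close> are cancelled by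
  \<open>\<Delta>\<^sub>\<plusminus>\<^sup>2\<close>. The two formulas for \<open>F\<close> are continuous up to the circle and agree there, so \<open>F\<close> is
  holomorphic across it, the extensions fit together to an entire function, and by Liouville
  the latter is a quadratic polynomial. The twisting and reality conditions and \<open>det F = 1\<close>
  determine the shape of its coefficients.
\<close>

section \<open>Gluing across the unit circle and a Liouville criterion\<close>

definition annulus :: "real \<Rightarrow> real \<Rightarrow> complex set" where
  "annulus r R = {z. r < norm z \<and> norm z < R}"

lemma open_annulus: "open (annulus r R)"
  unfolding annulus_def by (intro open_Collect_conj open_Collect_less continuous_intros)

text \<open>The substitution \<open>z = exp (\<i> w)\<close> straightens the circle to the real axis.\<close>
lemma holomorphic_on_paste_across_circle:
  assumes r: "0 < r"
    and holf: "f holomorphic_on annulus r 1" and holg: "f holomorphic_on annulus 1 R"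
    and contf: "continuous_on (annulus r R) f"
  shows "f holomorphic_on annulus r R"
proof -
  define S where "S = (\<lambda>w. exp (\<i> * w)) -` annulus r R"
  define g where "g = (\<lambda>w. f (exp (\<i> * w)))"
  have S: "open S"
    unfolding S_def by (intro open_vimage open_annulus continuous_intros)
  have n: "norm (exp (\<i> * w)) = exp (- Im w)" for w
    by simp
  \<comment> \<open>The direction \<i> with offset 0 describes the real axis, as
    \<open>\<i> \<bullet> w = Im w\<close>. By \<open>n\<close> the lower half plane corresponds to
    the outside of the circle and the upper one to the inside.\<close>
  have "g holomorphic_on S"
  proof (rule holomorphic_on_paste_across_line[OF S, of \<i> g 0])
    show "g holomorphic_on S \<inter> {z. \<i> \<bullet> z < 0}"
    proof -
      have "(f \<circ> (\<lambda>w. exp (\<i> * w))) holomorphic_on S \<inter> {z. \<i> \<bullet> z < 0}"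
        by (rule holomorphic_on_compose_gen[OF _ holg])
           (auto intro!: holomorphic_intros simp: S_def annulus_def inner_complex_def)
      then show ?thesis by (simp add: g_def o_def)
    qed
    show "g holomorphic_on S \<inter> {z. 0 < \<i> \<bullet> z}"
    proof -
      have "(f \<circ> (\<lambda>w. exp (\<i> * w))) holomorphic_on S \<inter> {z. 0 < \<i> \<bullet> z}"
        by (rule holomorphic_on_compose_gen[OF _ holf])
           (auto intro!: holomorphic_intros simp: S_def annulus_def inner_complex_def)
      then show ?thesis by (simp add: g_def o_def)
    qed
    show "continuous_on S g"
      unfolding g_def
      by (rule continuous_on_compose2[OF contf]) (auto intro!: continuous_intros simp: S_def)
  qed simp
  have "f field_differentiable at z" if z: "z \<in> annulus r R" for z
  proof -
    \<comment> \<open>A local inverse of \<open>\<lambda>w. exp (\<i> * w)\<close> at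
      \<open>z\<close>: the argument \<open>u / z\<close> of \<open>Ln\<close> equals 1 at
      \<open>u = z\<close>, hence stays off the branch cut whichever \<open>z\<close> is
      taken.\<close>
    define h where "h = (\<lambda>u. - \<i> * (Ln (u / z) + Ln z))"
    have z0: "z \<noteq> 0" using z r by (auto simp: annulus_def)
    have eh: "exp (\<i> * h u) = u" if "u \<noteq> 0" for u
      using that z0 by (simp add: h_def ring_distribs exp_add flip: mult.assoc)
    have hz: "h z \<in> S" using eh[OF z0] z by (simp add: S_def)
    have gd: "g field_differentiable at (h z)"
      using \<open>g holomorphic_on S\<close> S hz holomorphic_on_imp_differentiable_at by blast
    have "Ln field_differentiable at (z / z)"
      using z0 by (simp add: field_differentiable_at_Ln complex_nonpos_Reals_iff)
    then have "(Ln \<circ> (\<lambda>u. u / z)) field_differentiable at z"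
      by (intro field_differentiable_compose) (auto intro!: derivative_intros simp: z0)
    then have "h field_differentiable at z"
      unfolding h_def by (auto simp: o_def intro!: derivative_intros)
    then have "(g \<circ> h) field_differentiable at z"
      using gd by (rule field_differentiable_compose)
    then obtain D where "((g \<circ> h) has_field_derivative D) (at z)"
      by (auto simp: field_differentiable_def)
    then have "(f has_field_derivative D) (at z)"
      by (rule has_field_derivative_transform_within_open[of _ _ _ "- {0}"])
         (use z0 eh in \<open>auto simp: g_def\<close>)
    then show ?thesis by (auto simp: field_differentiable_def)
  qed
  then show ?thesis
    by (auto simp: holomorphic_on_def field_differentiable_at_within)
qed

text \<open>The three functions glue to an entire function of quadratic growth, so Liouville
  applies. The form \<open>z\<^sup>2 * g (1 / z)\<close> expresses a pole of order at most two at
  infinity through a function on the unit disc.\<close>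

lemma quadratic_on_circle_of_matching:
  assumes "0 \<le> r" "r < 1" "1 < R"
    and f: "f holomorphic_on ball 0 1" and g: "g holomorphic_on ball 0 1"
    and h: "h holomorphic_on annulus r R"
    and hf: "\<And>z. r < norm z \<Longrightarrow> norm z < 1 \<Longrightarrow> h z = f z"
    and hg: "\<And>z. 1 < norm z \<Longrightarrow> norm z < R \<Longrightarrow> h z = z\<^sup>2 * g (1 / z)"
  shows "\<exists>\<alpha> \<beta> \<gamma>. \<forall>z\<in>circle. h z = \<alpha> + \<beta> * z + \<gamma> * z\<^sup>2"
proof -
  \<comment> \<open>By \<open>hf\<close> and \<open>hg\<close>, \<open>E\<close> equals
    \<open>h\<close> on the whole annulus, which bridges the circle between the disc and the
    exterior.\<close>
  define E where "E z = (if norm z < 1 then f z else if norm z > 1 then z\<^sup>2 * g (1 / z) else h z)" for z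
  have "E holomorphic_on ball 0 1 \<union> (- cball 0 1) \<union> annulus r R"
  proof (intro holomorphic_on_Un)
    show "E holomorphic_on ball 0 1"
      using f by (rule holomorphic_transform) (auto simp: E_def)
    have "(g \<circ> (\<lambda>z. 1 / z)) holomorphic_on - cball 0 1"
      by (rule holomorphic_on_compose_gen[OF _ g])
         (auto intro!: holomorphic_intros simp: norm_divide divide_simps)
    then have "(\<lambda>z. z\<^sup>2 * g (1 / z)) holomorphic_on - cball 0 1"
      by (auto intro!: holomorphic_intros simp: o_def)
    then show "E holomorphic_on - cball 0 1"
      by (rule holomorphic_transform) (auto simp: E_def)
    show "E holomorphic_on annulus r R"
      using h by (rule holomorphic_transform) (auto simp: E_def annulus_def hf hg)
  qed (auto simp: open_annulus)
  moreover have "ball 0 1 \<union> (- cball 0 1) \<union> annulus r R = UNIV"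
    using assms(2,3) by (auto simp: annulus_def)
  ultimately have E: "E holomorphic_on UNIV" by simp
  \<comment> \<open>\<open>g\<close> may be unbounded near the circle. The compact disc of radius
    1/2 suffices, since \<open>1 / z\<close> maps \<open>2 \<le> norm z\<close> into it.\<close>
  have "continuous_on (cball 0 (1/2)) g"
    using g by (intro holomorphic_on_imp_continuous_on) (auto elim!: holomorphic_on_subset)
  then have "bounded (g ` cball 0 (1/2))"
    by (intro compact_imp_bounded compact_continuous_image) auto
  then obtain B where "\<forall>w\<in>cball 0 (1/2). norm (g w) \<le> B"
    by (auto simp: bounded_iff)
  then have B: "norm (g w) \<le> B" if "norm w \<le> 1/2" for w
    using that by (meson mem_cball_0)
  have bd: "norm (E z) \<le> B * norm z ^ 2" if "2 \<le> norm z" for z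
  proof -
    have "1 / norm z \<le> 1 / 2"
      using that by (intro divide_left_mono) auto
    then have "norm (1 / z) \<le> 1/2"
      by (simp only: norm_divide norm_one)
    then have "norm (z\<^sup>2) * norm (g (1 / z)) \<le> norm (z\<^sup>2) * B"
      by (intro mult_left_mono B) auto
    then show ?thesis
      using that by (simp add: E_def norm_mult norm_power mult.commute)
  qed
  define c where "c k = (deriv ^^ k) E 0 / fact k" for k
  have Ez: "E z = (\<Sum>k\<le>2. c k * z ^ k)" for z
    unfolding c_def by (rule Liouville_polynomial[OF E bd])
  have "h z = c 0 + c 1 * z + c 2 * z\<^sup>2" if "z \<in> circle" for z
  proof -
    have "h z = E z" using that by (simp add: E_def)
    then show ?thesis by (simp add: Ez numeral_2_eq_2)
  qed
  then show ?thesis by blast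
qed

text \<open>The points 1, -1 and \<i> of the circle already give an invertible linear
  system.\<close>

lemma laurent_coeffs_zero:
  fixes \<alpha> \<beta> \<gamma> :: complex
  assumes "\<And>z. z \<in> circle \<Longrightarrow> \<alpha> / z + \<beta> + \<gamma> * z = 0"
  shows "\<alpha> = 0" "\<beta> = 0" "\<gamma> = 0"
proof -
  have 1: "\<alpha> + \<beta> + \<gamma> = 0" "- \<alpha> + \<beta> - \<gamma> = 0" "- \<i> * \<alpha> + \<beta> + \<gamma> * \<i> = 0"
    using assms[of 1] assms[of "-1"] assms[of \<i>] by auto
  have b: "\<beta> = 0" using 1(1,2) by algebra
  have g: "\<gamma> = - \<alpha>" using 1(1) b by algebra
  have "\<i> * \<alpha> = 0" using 1(3) unfolding b g by (simp add: algebra_simps)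
  then have "\<alpha> = 0" by simp
  then show "\<alpha> = 0" "\<beta> = 0" "\<gamma> = 0" using b g by auto
qed

text \<open>A connected set with more than one point has no isolated points. This makes derivatives
  within the circle unique.\<close>

lemma at_within_circle_neq_bot:
  assumes "z \<in> circle"
  shows "at z within circle \<noteq> bot"
proof -
  have "connected circle" by (rule connected_sphere) simp
  moreover have "1 \<in> circle" "-1 \<in> circle" "(1::complex) \<noteq> -1" by auto
  then have "\<not> (\<exists>x. circle = {x})" by (metis singletonD)
  ultimately have "z islimpt circle"
    using assms connected_imp_perfect by blast
  then show ?thesis by (simp add: trivial_limit_within)
qed

section \<open>Algebra of 2 by 2 matrices\<close>

text \<open>The adjugate is the inverse where \<open>det\<close> is 1; having the entries of
  \<open>A\<close> up to sign, it stays holomorphic where nothing is known about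
  \<open>det\<close>.\<close>

definition adj2 :: "cmat \<Rightarrow> cmat" where
  "adj2 A = mat2 (A $ 2 $ 2) (- A $ 1 $ 2) (- A $ 2 $ 1) (A $ 1 $ 1)"

text \<open>The first Pauli matrix. \<open>A_plus\<close> is a scalar combination of it and the
  identity, so the two commute.\<close>

definition sigma1 :: cmat where "sigma1 = mat2 0 1 1 0"

lemma mat2_nth [simp]:
  "mat2 a b c d $ 1 $ 1 = a" "mat2 a b c d $ 1 $ 2 = b"
  "mat2 a b c d $ 2 $ 1 = c" "mat2 a b c d $ 2 $ 2 = d"
  by (auto simp: mat2_def)

lemma smul_nth [simp]: "smul c A $ i $ j = c * A $ i $ j"
  by (simp add: smul_def)

lemma ctrans_nth [simp]: "ctrans A $ i $ j = cnj (A $ j $ i)"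
  by (simp add: ctrans_def)

lemma matrix_mult_nth2: "((A::cmat) ** B) $ i $ j = A $ i $ 1 * B $ 1 $ j + A $ i $ 2 * B $ 2 $ j"
  by (simp add: matrix_matrix_mult_def sum_2)

lemma mat1_nth2 [simp]:
  "(mat 1 :: cmat) $ 1 $ 1 = 1" "(mat 1 :: cmat) $ 1 $ 2 = 0"
  "(mat 1 :: cmat) $ 2 $ 1 = 0" "(mat 1 :: cmat) $ 2 $ 2 = 1"
  by (auto simp: mat_def)

lemma adj2_nth [simp]:
  "adj2 A $ 1 $ 1 = A $ 2 $ 2" "adj2 A $ 1 $ 2 = - A $ 1 $ 2"
  "adj2 A $ 2 $ 1 = - A $ 2 $ 1" "adj2 A $ 2 $ 2 = A $ 1 $ 1"
  by (auto simp: adj2_def)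

lemma cmat_eq_iff:
  "(A::cmat) = B \<longleftrightarrow> A $ 1 $ 1 = B $ 1 $ 1 \<and> A $ 1 $ 2 = B $ 1 $ 2 \<and> A $ 2 $ 1 = B $ 2 $ 1 \<and> A $ 2 $ 2 = B $ 2 $ 2"
  by (auto simp: vec_eq_iff forall_2)

lemma adj2_mult: "adj2 (A ** B) = adj2 B ** adj2 A"
  by (simp add: cmat_eq_iff matrix_mult_nth2 algebra_simps)

lemma adj2_adj2 [simp]: "adj2 (adj2 A) = A"
  by (simp add: cmat_eq_iff)

lemma ctrans_mult: "ctrans (A ** B) = ctrans B ** ctrans A"
  by (simp add: cmat_eq_iff matrix_mult_nth2 algebra_simps)

lemma det_ctrans: "det (ctrans A) = cnj (det A)"
  by (simp add: det_2)

lemma adj2_mult_left: "det A = 1 \<Longrightarrow> adj2 A ** A = mat 1"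
  and adj2_mult_right: "det A = 1 \<Longrightarrow> A ** adj2 A = mat 1"
  by (simp_all add: cmat_eq_iff matrix_mult_nth2 det_2 algebra_simps)

lemma matrix_inv_eqI:
  fixes A B :: cmat
  assumes "A ** B = mat 1"
  shows "matrix_inv A = B"
proof -
  have BA: "B ** A = mat 1" using assms by (simp add: matrix_left_right_inverse)
  \<comment> \<open>\<open>matrix_inv\<close> is a choice; \<open>B\<close> shows that there is
    something to choose.\<close>
  have "A ** matrix_inv A = mat 1"
    unfolding matrix_inv_def by (rule someI2[of _ B]) (use assms BA in auto)
  then have "B ** (A ** matrix_inv A) = B" by simp
  then show ?thesis by (simp add: matrix_mul_assoc BA)
qed

lemma matrix_inv_det1: "det A = 1 \<Longrightarrow> matrix_inv A = adj2 A"
  by (intro matrix_inv_eqI adj2_mult_right)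

lemma matrix_inv_sigma3: "matrix_inv sigma3 = sigma3"
  by (intro matrix_inv_eqI) (simp add: cmat_eq_iff matrix_mult_nth2 sigma3_def)

lemma smul_mult_left: "smul c A ** B = smul c (A ** B)"
  and smul_mult_right: "A ** smul c B = smul c (A ** B)"
  by (simp_all add: cmat_eq_iff matrix_mult_nth2 algebra_simps)

lemma smul_smul [simp]: "smul c (smul d A) = smul (c * d) A"
  by (simp add: cmat_eq_iff)

section \<open>Entrywise complex calculus for matrix-valued functions\<close>

definition has_mderiv :: "(complex \<Rightarrow> cmat) \<Rightarrow> cmat \<Rightarrow> complex filter \<Rightarrow> bool" where
  "has_mderiv M D F \<longleftrightarrow> (\<forall>i j. ((\<lambda>z. M z $ i $ j) has_field_derivative D $ i $ j) F)"

definition mderiv :: "(complex \<Rightarrow> cmat) \<Rightarrow> complex \<Rightarrow> cmat" where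
  "mderiv M z = (\<chi> i j. deriv (\<lambda>z. M z $ i $ j) z)"

definition mhol :: "(complex \<Rightarrow> cmat) \<Rightarrow> complex set \<Rightarrow> bool" where
  "mhol M S \<longleftrightarrow> (\<forall>i j. (\<lambda>z. M z $ i $ j) holomorphic_on S)"

definition mcont :: "complex set \<Rightarrow> (complex \<Rightarrow> cmat) \<Rightarrow> bool" where
  "mcont S M \<longleftrightarrow> (\<forall>i j. continuous_on S (\<lambda>z. M z $ i $ j))"

lemma has_mderiv_mult:
  assumes "has_mderiv M M' (at z within S)" "has_mderiv N N' (at z within S)"
  shows "has_mderiv (\<lambda>z. M z ** N z) (M' ** N z + M z ** N') (at z within S)"
  using assms unfolding has_mderiv_def matrix_mult_nth2
  by (auto intro!: derivative_eq_intros simp: matrix_mult_nth2 algebra_simps)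

lemma has_mderiv_const: "has_mderiv (\<lambda>z. A) 0 F"
  by (simp add: has_mderiv_def)

lemma has_mderiv_inverse:
  assumes "has_mderiv M D (at (1 / z))" "z \<noteq> 0"
  shows "has_mderiv (\<lambda>z. M (1 / z)) (smul (- 1 / z\<^sup>2) D) (at z)"
  unfolding has_mderiv_def
proof (intro allI)
  fix i j
  have "((\<lambda>z. 1 / z) has_field_derivative - 1 / z\<^sup>2) (at z)"
    using assms(2) by (auto intro!: derivative_eq_intros simp: power2_eq_square)
  moreover have "((\<lambda>w. M w $ i $ j) has_field_derivative D $ i $ j) (at (1 / z))"
    using assms(1) by (simp add: has_mderiv_def)
  ultimately have "((\<lambda>z. M (1 / z) $ i $ j) has_field_derivative D $ i $ j * (- 1 / z\<^sup>2)) (at z)"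
    by (intro DERIV_chain2[of "\<lambda>w. M w $ i $ j"])
  then show "((\<lambda>z. M (1 / z) $ i $ j) has_field_derivative smul (- 1 / z\<^sup>2) D $ i $ j) (at z)"
    by (simp only: smul_nth mult.commute)
qed

lemma has_mderiv_transform_open:
  assumes "has_mderiv M D (at z)" "open S" "z \<in> S" "\<And>w. w \<in> S \<Longrightarrow> M w = N w"
  shows "has_mderiv N D (at z)"
  unfolding has_mderiv_def
proof (intro allI)
  fix i j
  show "((\<lambda>z. N z $ i $ j) has_field_derivative D $ i $ j) (at z)"
    by (rule has_field_derivative_transform_within_open[of "\<lambda>z. M z $ i $ j" _ _ S])
       (use assms in \<open>auto simp: has_mderiv_def\<close>)
qed

lemma has_mderiv_unique:
  assumes "has_mderiv M D (at z)" "has_mderiv M D' (at z)"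
  shows "D = D'"
proof -
  have "D $ i $ j = D' $ i $ j" for i j
    using assms unfolding has_mderiv_def by (blast intro: DERIV_unique)
  then show ?thesis by (simp add: vec_eq_iff)
qed

lemma mhol_has_mderiv:
  assumes "mhol M S" "open S" "z \<in> S"
  shows "has_mderiv M (mderiv M z) (at z)"
  using assms by (auto simp: has_mderiv_def mderiv_def mhol_def intro!: holomorphic_derivI)

lemma mholI: "(\<And>z. z \<in> S \<Longrightarrow> \<exists>D. has_mderiv M D (at z)) \<Longrightarrow> mhol M S"
  unfolding mhol_def holomorphic_on_def field_differentiable_def has_mderiv_def
  by (meson has_field_derivative_at_within)

lemma mhol_subset: "mhol M S \<Longrightarrow> T \<subseteq> S \<Longrightarrow> mhol M T"
  unfolding mhol_def by (meson holomorphic_on_subset)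

lemma mhol_mderiv: "mhol M S \<Longrightarrow> open S \<Longrightarrow> mhol (mderiv M) S"
  by (auto simp: mhol_def mderiv_def intro!: holomorphic_deriv)

lemma mhol_mult: "mhol M S \<Longrightarrow> mhol N S \<Longrightarrow> mhol (\<lambda>z. M z ** N z) S"
  by (auto simp: mhol_def matrix_mult_nth2 intro!: holomorphic_intros)

lemma mhol_adj2: "mhol M S \<Longrightarrow> mhol (\<lambda>z. adj2 (M z)) S"
  by (auto simp: mhol_def forall_2 intro!: holomorphic_intros)

lemma mhol_smul: "f holomorphic_on S \<Longrightarrow> mhol M S \<Longrightarrow> mhol (\<lambda>z. smul (f z) (M z)) S"
  by (auto simp: mhol_def intro!: holomorphic_intros)

lemma mhol_add: "mhol M S \<Longrightarrow> mhol N S \<Longrightarrow> mhol (\<lambda>z. M z + N z) S"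
  by (auto simp: mhol_def intro!: holomorphic_intros)

lemma mhol_const: "mhol (\<lambda>z. A) S"
  by (auto simp: mhol_def)

lemma mcont_mult: "mcont S M \<Longrightarrow> mcont S N \<Longrightarrow> mcont S (\<lambda>z. M z ** N z)"
  by (auto simp: mcont_def matrix_mult_nth2 intro!: continuous_on_add continuous_on_mult)

lemma mhol_imp_mcont: "mhol M S \<Longrightarrow> mcont S M"
  by (simp add: mhol_def mcont_def holomorphic_on_imp_continuous_on)

lemma mcont_subset: "mcont S M \<Longrightarrow> T \<subseteq> S \<Longrightarrow> mcont T M"
  unfolding mcont_def by (meson continuous_on_subset)

lemma mhol_inverse:
  assumes "mhol M S" "\<And>z. z \<in> T \<Longrightarrow> z \<noteq> 0 \<and> 1 / z \<in> S"
  shows "mhol (\<lambda>z. M (1 / z)) T"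
  unfolding mhol_def
proof (intro allI)
  fix i j
  have "((\<lambda>w. M w $ i $ j) \<circ> (\<lambda>z. 1 / z)) holomorphic_on T"
    by (rule holomorphic_on_compose_gen[of _ _ _ S]) (use assms in \<open>auto simp: mhol_def intro!: holomorphic_intros\<close>)
  then show "(\<lambda>z. M (1 / z) $ i $ j) holomorphic_on T" by (simp add: o_def)
qed

lemma mcont_inverse:
  assumes "mcont S M" "\<And>z. z \<in> T \<Longrightarrow> z \<noteq> 0 \<and> 1 / z \<in> S"
  shows "mcont T (\<lambda>z. M (1 / z))"
  unfolding mcont_def
proof (intro allI)
  fix i j
  show "continuous_on T (\<lambda>z. M (1 / z) $ i $ j)"
    by (rule continuous_on_compose2[of S "\<lambda>w. M w $ i $ j"])
       (use assms in \<open>auto simp: mcont_def intro!: continuous_intros\<close>)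
qed

text \<open>In a product the logarithmic derivative of the left factor gets conjugated by the right
  one. With \<open>adj2\<close> in place of the inverse, \<open>det\<close> enters only for
  \<open>P\<close>; this suits extensions of loops, whose determinant is known on the circle
  only.\<close>

lemma log_deriv_mult:
  assumes P: "has_mderiv P P' (at z)" and V: "has_mderiv V V' (at z)"
    and d: "det (P z) = 1" and L: "adj2 (P z) ** P' = smul c sigma1"
  shows "\<exists>D. has_mderiv (\<lambda>z. P z ** V z) D (at z) \<and>
    adj2 (P z ** V z) ** D = smul c (adj2 (V z) ** sigma1 ** V z) + adj2 (V z) ** V'"
proof (intro exI conjI)
  have "adj2 (P z ** V z) ** (P' ** V z + P z ** V') =
      adj2 (V z) ** (adj2 (P z) ** P') ** V z + adj2 (V z) ** (adj2 (P z) ** P z) ** V'"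
    by (simp add: adj2_mult matrix_add_ldistrib matrix_mul_assoc)
  also have "\<dots> = smul c (adj2 (V z) ** sigma1 ** V z) + adj2 (V z) ** V'"
    by (simp add: L adj2_mult_left[OF d] smul_mult_left smul_mult_right)
  finally show "adj2 (P z ** V z) ** (P' ** V z + P z ** V') = \<dots>" .
qed (rule has_mderiv_mult[OF P V])

section \<open>The factors \<open>F_plus\<close> and \<open>G_minus\<close>\<close>

text \<open>The disc on which \<open>Delta_plus\<close> is holomorphic without zeros; for
  \<open>\<bar>q / 2\<bar> < 1\<close> it contains the closed unit disc.\<close>

definition Lambda_disc :: "real \<Rightarrow> complex set" where
  "Lambda_disc q = {z. \<bar>q / 2\<bar> * norm z < 1}"

text \<open>The second summand has norm below 1, so the real part stays positive and
  \<open>csqrt\<close> is off its cut.\<close>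

lemma Delta_radicand:
  assumes "z \<in> Lambda_disc q"
  shows "1 + (of_real q / 2)\<^sup>2 * z\<^sup>2 \<notin> \<real>\<^sub>\<le>\<^sub>0"
proof
  assume "1 + (of_real q / 2)\<^sup>2 * z\<^sup>2 \<in> \<real>\<^sub>\<le>\<^sub>0"
  then have "1 + Re ((of_real q / 2)\<^sup>2 * z\<^sup>2) \<le> 0"
    by (simp add: complex_nonpos_Reals_iff)
  moreover have "\<bar>Re ((of_real q / 2)\<^sup>2 * z\<^sup>2)\<bar> \<le> norm ((of_real q / 2)\<^sup>2 * z\<^sup>2)"
    by (rule abs_Re_le_cmod)
  moreover have "norm ((of_real q / 2)\<^sup>2 * z\<^sup>2) = (\<bar>q / 2\<bar> * norm z)\<^sup>2"
    by (simp add: norm_mult norm_power power_mult_distrib norm_divide power_divide)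
  moreover have "(\<bar>q / 2\<bar> * norm z)\<^sup>2 < 1"
    using assms by (simp add: Lambda_disc_def abs_square_less_1)
  ultimately show False by linarith
qed

lemma Delta_plus_sq: "(Delta_plus q z)\<^sup>2 = 1 + (of_real q / 2)\<^sup>2 * z\<^sup>2"
  by (simp add: Delta_plus_def)

lemma Delta_plus_nz: "z \<in> Lambda_disc q \<Longrightarrow> Delta_plus q z \<noteq> 0"
  using Delta_radicand[of z q] by (auto simp: Delta_plus_def)

lemma Delta_plus_cnj: "z \<in> Lambda_disc q \<Longrightarrow> cnj (Delta_plus q (cnj z)) = Delta_plus q z"
  using Delta_radicand[of "cnj z" q]
  by (simp add: Delta_plus_def cnj_csqrt Lambda_disc_def)

lemma has_field_derivative_Delta_plus:
  assumes "z \<in> Lambda_disc q"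
  shows "(Delta_plus q has_field_derivative (of_real q / 2)\<^sup>2 * z / Delta_plus q z) (at z)"
  unfolding Delta_plus_def
  by (rule derivative_eq_intros refl | use Delta_radicand[OF assms] in simp)+

lemma A_plus_nth:
  "A_plus q z $ 1 $ 1 = 1 / Delta_plus q z" "A_plus q z $ 1 $ 2 = \<i> / 2 * of_real q * z / Delta_plus q z"
  "A_plus q z $ 2 $ 1 = \<i> / 2 * of_real q * z / Delta_plus q z" "A_plus q z $ 2 $ 2 = 1 / Delta_plus q z"
  by (simp_all add: A_plus_def)

lemma det_A_plus:
  assumes "z \<in> Lambda_disc q"
  shows "det (A_plus q z) = 1"
proof -
  have "det (A_plus q z) = (1 / Delta_plus q z)\<^sup>2 - (\<i> / 2 * of_real q * z / Delta_plus q z)\<^sup>2"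
    by (simp add: det_2 A_plus_nth power2_eq_square)
  also have "\<dots> = (1 + (of_real q / 2)\<^sup>2 * z\<^sup>2) / (Delta_plus q z)\<^sup>2"
    by (simp add: power_mult_distrib power_divide add_divide_distrib)
  finally have "det (A_plus q z) = \<dots>" .
  then show ?thesis
    using Delta_plus_nz[OF assms] by (simp flip: Delta_plus_sq)
qed

text \<open>Formally \<open>A_plus\<close> is exp(\<i> \<theta> \<sigma>1) with tan \<theta> = q z /
  2, and \<theta>' = (q / 2) / Delta_plus^2. The proof checks this entry by entry.\<close>

lemma has_mderiv_A_plus:
  assumes "z \<in> Lambda_disc q"
  shows "has_mderiv (A_plus q) (smul (\<i> / 2 * of_real q / (Delta_plus q z)\<^sup>2) (sigma1 ** A_plus q z)) (at z)"
proof -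
  note D = has_field_derivative_Delta_plus[OF assms] and nz = Delta_plus_nz[OF assms]
  define d where "d = Delta_plus q z"
  have d2: "d\<^sup>2 = 1 + (of_real q / 2)\<^sup>2 * z\<^sup>2" "d \<noteq> 0"
    using nz by (auto simp: d_def Delta_plus_sq)
  have 1: "((\<lambda>z. 1 / Delta_plus q z) has_field_derivative
      \<i> / 2 * of_real q / (Delta_plus q z)\<^sup>2 * (\<i> / 2 * of_real q * z / Delta_plus q z)) (at z)"
    by (rule derivative_eq_intros D refl nz)+
       (simp add: field_simps power2_eq_square)
  \<comment> \<open>The left side is what the quotient rule produces; its numerator collapses
    because \<open>d\<^sup>2 - (of_real q / 2)\<^sup>2 * z\<^sup>2 = 1\<close>.\<close>
  have "(\<i> / 2 * of_real q * d - \<i> / 2 * of_real q * z * ((of_real q / 2)\<^sup>2 * z / d)) / (d * d)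
      = \<i> / 2 * of_real q / d\<^sup>2 * (1 / d)"
  proof -
    have "(\<i> / 2 * of_real q * d - \<i> / 2 * of_real q * z * ((of_real q / 2)\<^sup>2 * z / d)) / (d * d)
      = \<i> / 2 * of_real q * (d\<^sup>2 - (of_real q / 2)\<^sup>2 * z\<^sup>2) / (d * d * d)"
      using d2(2) by (simp add: field_simps power2_eq_square)
    also have "\<dots> = \<i> / 2 * of_real q / (d * d * d)"
      unfolding d2(1) by simp
    finally show ?thesis by (simp add: power2_eq_square)
  qed
  then have 2: "((\<lambda>z. \<i> / 2 * of_real q * z / Delta_plus q z) has_field_derivative
      \<i> / 2 * of_real q / (Delta_plus q z)\<^sup>2 * (1 / Delta_plus q z)) (at z)"
    by - ((rule derivative_eq_intros D refl nz)+, simp add: d_def)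
  show ?thesis
    unfolding has_mderiv_def forall_2 A_plus_nth smul_nth matrix_mult_nth2 sigma1_def mat2_nth
    using 1 2 by simp
qed

lemma sigma1_A_plus: "sigma1 ** A_plus q z = A_plus q z ** sigma1"
  by (simp add: cmat_eq_iff matrix_mult_nth2 A_plus_nth sigma1_def)

lemma sigma1_mpow: "sigma1 ** mpow (A_plus q z) n = mpow (A_plus q z) n ** sigma1"
proof (induction n)
  case (Suc n)
  have "sigma1 ** mpow (A_plus q z) (Suc n) = A_plus q z ** (sigma1 ** mpow (A_plus q z) n)"
    by (simp add: matrix_mul_assoc sigma1_A_plus)
  then show ?case by (simp add: Suc matrix_mul_assoc)
qed simp

lemma det_mpow: "det A = 1 \<Longrightarrow> det (mpow A n) = 1"
  by (induction n) (auto simp: det_mul)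

lemma det_F_plus:
  assumes "z \<in> Lambda_disc q"
  shows "det (F_plus q s n z) = 1"
proof -
  have "det (mat2 (exp (\<i> * of_real s)) 0 0 (exp (- \<i> * of_real s))) = 1"
    by (simp add: det_2 flip: exp_add)
  then show ?thesis
    by (simp add: F_plus_def det_mul det_mpow det_A_plus[OF assms])
qed

text \<open>\<open>sigma1\<close> commutes with \<open>A_plus\<close>, so the logarithmic
  derivatives of the \<open>n\<close> factors simply add up.\<close>

lemma has_mderiv_mpow_A_plus:
  assumes "z \<in> Lambda_disc q"
  shows "has_mderiv (\<lambda>z. mpow (A_plus q z) n)
    (smul (of_nat n * (\<i> / 2 * of_real q) / (Delta_plus q z)\<^sup>2) (sigma1 ** mpow (A_plus q z) n)) (at z)"
proof (induction n)
  case 0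
  have "smul 0 A = 0" for A by (simp add: cmat_eq_iff)
  then show ?case by (simp add: has_mderiv_const)
next
  case (Suc n)
  have "A_plus q z ** (sigma1 ** mpow (A_plus q z) n) = sigma1 ** (A_plus q z ** mpow (A_plus q z) n)"
    by (simp add: matrix_mul_assoc sigma1_A_plus)
  moreover have "smul a A + smul b A = smul (a + b) A" for a b A
    by (simp add: cmat_eq_iff algebra_simps)
  ultimately show ?case
    using has_mderiv_mult[OF has_mderiv_A_plus[OF assms] Suc]
    by (simp add: smul_mult_left smul_mult_right algebra_simps flip: matrix_mul_assoc add_divide_distrib)
qed

text \<open>The constant diagonal factor cancels and \<open>sigma1\<close> commutes with the power,
  so a scalar multiple of \<open>sigma1\<close> remains, whose only singularities are the zeros of
  the square of \<open>Delta_plus\<close>.\<close>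

lemma has_mderiv_F_plus:
  assumes "z \<in> Lambda_disc q"
  obtains D where "has_mderiv (F_plus q s n) D (at z)"
    "adj2 (F_plus q s n z) ** D = smul (of_nat n * (\<i> / 2 * of_real q) / (Delta_plus q z)\<^sup>2) sigma1"
proof -
  define T where "T = mat2 (exp (\<i> * of_real s)) 0 0 (exp (- \<i> * of_real s))"
  define c where "c = of_nat n * (\<i> / 2 * of_real q) / (Delta_plus q z)\<^sup>2"
  define M where "M = mpow (A_plus q z) n"
  have F: "F_plus q s n = (\<lambda>z. T ** mpow (A_plus q z) n)"
    by (simp add: fun_eq_iff F_plus_def T_def)
  have "det T = 1" by (simp add: T_def det_2 flip: exp_add)
  note T = adj2_mult_left[OF this]
  have M: "adj2 M ** M = mat 1"
    by (simp add: M_def adj2_mult_left det_mpow det_A_plus assms)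
  define D where "D = 0 ** M + T ** smul c (sigma1 ** M)"
  have "has_mderiv (F_plus q s n) D (at z)"
    unfolding F c_def M_def D_def
    by (intro has_mderiv_mult has_mderiv_const has_mderiv_mpow_A_plus assms)
  moreover have "adj2 (F_plus q s n z) ** D = smul c (adj2 M ** (adj2 T ** T) ** (sigma1 ** M))"
    by (simp add: F D_def adj2_mult smul_mult_left smul_mult_right matrix_mul_assoc flip: M_def)
  moreover have "\<dots> = smul c (adj2 M ** M ** sigma1)"
    by (simp add: T M_def sigma1_mpow flip: matrix_mul_assoc)
  ultimately show thesis
    using that[of D] by (simp add: M c_def)
qed

lemma mhol_F_plus: "mhol (F_plus q s n) (Lambda_disc q)"
  by (intro mholI) (meson has_mderiv_F_plus)

lemma Delta_minus_eq: "Delta_minus q z = Delta_plus (- q) (1 / z)"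
  by (simp add: Delta_minus_def Delta_plus_def power_int_minus field_simps)

text \<open>\<open>A_minus\<close> carries the opposite sign of \<open>q\<close> and the inverse
  parameter. Every fact about \<open>F_plus\<close> thereby transfers to
  \<open>G_minus\<close>.\<close>

lemma G_minus_eq: "G_minus q l m z = F_plus (- q) l m (1 / z)"
proof -
  have "A_minus q z = A_plus (- q) (1 / z)"
    by (simp add: A_minus_def A_plus_def Delta_minus_eq inverse_eq_divide)
  then show ?thesis by (simp add: G_minus_def F_plus_def)
qed

lemma Lambda_disc_minus [simp]: "Lambda_disc (- q) = Lambda_disc q"
  by (simp add: Lambda_disc_def)

text \<open>\<open>ctrans\<close> and \<open>adj2\<close> both reverse products, so the factors can
  be treated one by one. On the disc \<open>csqrt\<close> commutes with conjugation, and conjugating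
  \<i> gives the sign that \<open>adj2\<close> puts on the off-diagonal entries.\<close>

lemma F_plus_reality:
  assumes "z \<in> Lambda_disc q"
  shows "ctrans (F_plus q s n (cnj z)) = adj2 (F_plus q s n z)"
proof -
  have A: "ctrans (A_plus q (cnj z)) = adj2 (A_plus q z)"
    by (simp add: cmat_eq_iff A_plus_nth Delta_plus_cnj[OF assms])
  have "ctrans (mpow (A_plus q (cnj z)) n) = adj2 (mpow (A_plus q z) n)"
    by (induction n) (simp_all add: cmat_eq_iff[of _ "adj2 (mat 1)"], simp add: ctrans_mult adj2_mult A)
  then show ?thesis
    by (simp add: F_plus_def ctrans_mult adj2_mult)
       (rule arg_cong[where f = "(**) _"], simp add: cmat_eq_iff exp_cnj)
qed

text \<open>Conjugation by \<open>sigma3\<close> changes the sign of the off-diagonal entries; those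
  of \<open>A_plus\<close> are odd in \<open>z\<close>, the diagonal ones even.\<close>

lemma F_plus_twisted: "sigma3 ** F_plus q s n z ** sigma3 = F_plus q s n (- z)"
proof -
  have s: "sigma3 ** sigma3 = mat 1"
    by (simp add: cmat_eq_iff matrix_mult_nth2 sigma3_def)
  have A: "A_plus q (- z) = sigma3 ** A_plus q z ** sigma3"
    by (simp add: cmat_eq_iff A_plus_nth matrix_mult_nth2 sigma3_def Delta_plus_def)
  have "mpow (A_plus q (- z)) n = sigma3 ** mpow (A_plus q z) n ** sigma3"
  proof (induction n)
    case (Suc n)
    have "mpow (A_plus q (- z)) (Suc n) = A_plus q (- z) ** mpow (A_plus q (- z)) n"
      by simp
    also have "\<dots> = sigma3 ** A_plus q z ** (sigma3 ** sigma3) ** mpow (A_plus q z) n ** sigma3"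
      unfolding Suc unfolding A by (simp only: matrix_mul_assoc)
    finally have "mpow (A_plus q (- z)) (Suc n) = \<dots>" .
    then show ?case by (simp add: s matrix_mul_assoc)
  qed (simp add: s)
  then show ?thesis
    by (simp add: F_plus_def matrix_mul_assoc)
       (rule arg_cong[where f = "\<lambda>x. x ** _ ** _"], simp add: cmat_eq_iff matrix_mult_nth2 sigma3_def)
qed

section \<open>Continuation of \<open>F\<close> across the circle and its logarithmic
  derivative\<close>

text \<open>This annulus is invariant under \<open>1 / z\<close>, and on it both
  \<open>F_plus\<close> and \<open>G_minus\<close> are holomorphic.\<close>

lemma annulus_Lambda_disc:
  assumes "z \<in> annulus \<bar>q / 2\<bar> (1 / \<bar>q / 2\<bar>)"
  shows "z \<noteq> 0" "z \<in> Lambda_disc q" "1 / z \<in> Lambda_disc q"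
proof -
  have n: "norm z > 0" using assms unfolding annulus_def by (auto intro: le_less_trans[OF abs_ge_zero])
  then show "z \<noteq> 0" by auto
  \<comment> \<open>For \<open>q = 0\<close> the outer radius is 1 / 0 = 0, so the annulus is
    empty.\<close>
  have "\<bar>q / 2\<bar> > 0"
    using assms n by (cases "q = 0") (auto simp: annulus_def)
  then show "z \<in> Lambda_disc q"
    using assms unfolding annulus_def Lambda_disc_def by (auto simp: field_simps)
  show "1 / z \<in> Lambda_disc q"
    using assms n by (simp add: annulus_def Lambda_disc_def norm_divide divide_less_eq)
qed

text \<open>\<open>H\<close> stands for the extension of \<open>Vp\<close>, and \<open>K\<close> for
  that of \<open>Vm\<close> in the chart \<open>1 / z\<close>. The two products are continuous up to
  the circle from their own sides and agree there. Gluing them provides complex derivatives for a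
  function that the loops give on the circle only.\<close>

lemma analytic_continuation_across_circle:
  assumes q: "0 < \<bar>q / 2\<bar>" "\<bar>q / 2\<bar> < 1"
    and H: "mhol H (ball 0 1)" "mcont (cball 0 1) H"
    and K: "mhol K (ball 0 1)" "mcont (cball 0 1) K"
    and eq: "\<And>z. z \<in> circle \<Longrightarrow> F_plus q s n z ** K (1 / z) = F_plus (- q) l m (1 / z) ** H z"
  obtains F where "mhol F (annulus \<bar>q / 2\<bar> (1 / \<bar>q / 2\<bar>))"
    "\<And>z. norm z \<le> 1 \<Longrightarrow> F z = F_plus (- q) l m (1 / z) ** H z"
    "\<And>z. 1 \<le> norm z \<Longrightarrow> F z = F_plus q s n z ** K (1 / z)"
proof -
  define r where "r = \<bar>q / 2\<bar>"
  define X where "X z = F_plus (- q) l m (1 / z) ** H z" for z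
  define Y where "Y z = F_plus q s n z ** K (1 / z)" for z
  define F where "F z = (if norm z \<le> 1 then X z else Y z)" for z
  have r: "0 < r" "r < 1" using q by (auto simp: r_def)
  have R: "1 < 1 / r" using r by simp
  have D: "z \<noteq> 0" "z \<in> Lambda_disc q" "1 / z \<in> Lambda_disc (- q)" if "z \<in> annulus r (1 / r)" for z
    using annulus_Lambda_disc that by (auto simp: r_def)
  have sub: "annulus r 1 \<subseteq> annulus r (1 / r)" "annulus 1 (1 / r) \<subseteq> annulus r (1 / r)"
    using r by (auto simp: annulus_def intro: less_trans[OF _ R])
  have FX: "F z = X z" if "norm z \<le> 1" for z
    using that by (simp add: F_def)
  have FY: "F z = Y z" if "1 \<le> norm z" for z
    using that eq[of z] by (auto simp: F_def X_def Y_def)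
  have XY: "X z = Y z" if "norm z = 1" for z
    using FX[of z] FY[of z] that by simp
  have X: "mhol X (annulus r 1)"
    unfolding X_def
  proof (intro mhol_mult)
    show "mhol (\<lambda>z. F_plus (- q) l m (1 / z)) (annulus r 1)"
      by (rule mhol_inverse[OF mhol_F_plus]) (use D sub in blast)
    show "mhol H (annulus r 1)" using H(1) by (rule mhol_subset) (auto simp: annulus_def)
  qed
  have Y: "mhol Y (annulus 1 (1 / r))"
    unfolding Y_def
  proof (intro mhol_mult)
    show "mhol (F_plus q s n) (annulus 1 (1 / r))"
      by (rule mhol_subset[OF mhol_F_plus]) (use D sub in blast)
    show "mhol (\<lambda>z. K (1 / z)) (annulus 1 (1 / r))"
      by (rule mhol_inverse[OF K(1)]) (auto simp: annulus_def norm_divide divide_simps)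
  qed
  have cX: "mcont {z \<in> annulus r (1 / r). norm z \<le> 1} X"
    unfolding X_def
  proof (intro mcont_mult)
    show "mcont {z \<in> annulus r (1 / r). norm z \<le> 1} (\<lambda>z. F_plus (- q) l m (1 / z))"
      by (rule mcont_inverse[OF mhol_imp_mcont[OF mhol_F_plus]]) (use D in blast)
    show "mcont {z \<in> annulus r (1 / r). norm z \<le> 1} H" using H(2) by (rule mcont_subset) auto
  qed
  have cY: "mcont {z \<in> annulus r (1 / r). 1 \<le> norm z} Y"
    unfolding Y_def
  proof (intro mcont_mult)
    show "mcont {z \<in> annulus r (1 / r). 1 \<le> norm z} (F_plus q s n)"
      by (rule mcont_subset[OF mhol_imp_mcont[OF mhol_F_plus]]) (use D in blast)
    show "mcont {z \<in> annulus r (1 / r). 1 \<le> norm z} (\<lambda>z. K (1 / z))"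
      by (rule mcont_inverse[OF K(2)]) (auto simp: norm_divide divide_simps)
  qed
  have "mhol F (annulus r (1 / r))"
    unfolding mhol_def
  proof (intro allI)
    fix i j
    have "(\<lambda>z. X z $ i $ j) holomorphic_on annulus r 1"
      using X by (simp add: mhol_def)
    then have X': "(\<lambda>z. F z $ i $ j) holomorphic_on annulus r 1"
      by (rule holomorphic_transform) (simp add: annulus_def FX)
    have "(\<lambda>z. Y z $ i $ j) holomorphic_on annulus 1 (1 / r)"
      using Y by (simp add: mhol_def)
    then have Y': "(\<lambda>z. F z $ i $ j) holomorphic_on annulus 1 (1 / r)"
      by (rule holomorphic_transform) (simp add: annulus_def FY)
    have "continuous_on (annulus r (1 / r)) (\<lambda>z. if norm z \<le> 1 then X z $ i $ j else Y z $ i $ j)"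
      using cX cY
      by (intro continuous_on_cases_le) (auto simp: mcont_def XY intro!: continuous_on_norm)
    then have "continuous_on (annulus r (1 / r)) (\<lambda>z. F z $ i $ j)"
      by (auto simp: F_def elim: continuous_on_eq)
    with r(1) X' Y' show "(\<lambda>z. F z $ i $ j) holomorphic_on annulus r (1 / r)"
      by (rule holomorphic_on_paste_across_circle)
  qed
  then show thesis
    by (intro that[of F]) (auto simp: r_def FX FY X_def Y_def)
qed

text \<open>Equals \<open>\<lambda>\<^sup>2 \<Delta>\<^sub>+\<^sup>2 \<Delta>\<^sub>-\<^sup>2 F\<inverse> F'\<close> at \<open>\<lambda> = z\<close> inside the disk for \<open>U = V\<^sub>+\<close>, and its
  multiple by \<open>- z\<^sup>2\<close> at \<open>\<lambda> = 1 / z\<close> for \<open>U(z) = V\<^sub>-(1 / z)\<close>.\<close>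
definition cleared_log_deriv :: "real \<Rightarrow> complex \<Rightarrow> (complex \<Rightarrow> cmat) \<Rightarrow> complex \<Rightarrow> cmat" where
  "cleared_log_deriv q c U z = smul (1 + (of_real q / 2)\<^sup>2 * z\<^sup>2)
     (smul c (adj2 (U z) ** sigma1 ** U z) + smul (z\<^sup>2 + (of_real q / 2)\<^sup>2) (adj2 (U z) ** mderiv U z))"

lemma mhol_cleared_log_deriv:
  assumes "mhol U S" "open S"
  shows "mhol (cleared_log_deriv q c U) S"
  unfolding cleared_log_deriv_def
  by (intro mhol_smul mhol_add mhol_mult mhol_adj2 mhol_const mhol_mderiv assms holomorphic_intros)

lemma smul_add: "smul c (A + B) = smul c A + smul c B"
  by (simp add: cmat_eq_iff algebra_simps)

text \<open>Inside the disc the factor \<open>G_minus\<close> contributes poles where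
  \<open>z\<^sup>2 = - t\<close>, outside it \<open>F_plus\<close> contributes poles where
  \<open>t * z\<^sup>2 = - 1\<close>. The two polynomial factors cancel them, and their product is
  \<open>z\<^sup>2\<close> times the squares of \<open>Delta_plus\<close> and
  \<open>Delta_minus\<close>.\<close>

lemma log_deriv_quadratic:
  fixes q :: real
  defines "t \<equiv> (of_real q / 2)\<^sup>2"
  assumes q: "0 < \<bar>q / 2\<bar>" "\<bar>q / 2\<bar> < 1"
    and H: "mhol H (ball 0 1)" and K: "mhol K (ball 0 1)"
    and F: "mhol F (annulus \<bar>q / 2\<bar> (1 / \<bar>q / 2\<bar>))"
    and FH: "\<And>z. norm z \<le> 1 \<Longrightarrow> F z = F_plus (- q) l m (1 / z) ** H z"
    and FK: "\<And>z. 1 \<le> norm z \<Longrightarrow> F z = F_plus q s n z ** K (1 / z)"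
  shows "\<exists>\<alpha> \<beta> \<gamma>. \<forall>z\<in>circle. (1 + t * z\<^sup>2) * (z\<^sup>2 + t) * (adj2 (F z) ** mderiv F z) $ i $ j
    = \<alpha> + \<beta> * z + \<gamma> * z\<^sup>2"
proof -
  define r where "r = \<bar>q / 2\<bar>"
  define \<kappa> where "\<kappa> = \<i> / 2 * of_real q"
  have r: "0 < r" "r < 1" using q by (auto simp: r_def)
  have D: "z \<noteq> 0" "z \<in> Lambda_disc q" "1 / z \<in> Lambda_disc (- q)" if "z \<in> annulus r (1 / r)" for z
    using annulus_Lambda_disc that by (auto simp: r_def)
  have nz: "1 + t * z\<^sup>2 \<noteq> 0" "z\<^sup>2 + t \<noteq> 0" if "z \<in> annulus r (1 / r)" for z
  proof -
    show "1 + t * z\<^sup>2 \<noteq> 0"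
      using Delta_plus_nz[OF D(2)[OF that]] Delta_plus_sq[of q z] by (auto simp: t_def)
    have "1 + t * (1 / z)\<^sup>2 \<noteq> 0"
      using Delta_plus_nz[OF D(3)[OF that]] Delta_plus_sq[of "- q" "1 / z"] by (auto simp: t_def)
    then show "z\<^sup>2 + t \<noteq> 0"
      using D(1)[OF that] by (auto simp: power_divide divide_simps)
  qed
  have mF: "has_mderiv F (mderiv F z) (at z)" if "z \<in> annulus r (1 / r)" for z
    using F that by (intro mhol_has_mderiv[of F "annulus r (1 / r)"]) (auto simp: r_def open_annulus)
  have inner: "smul ((1 + t * z\<^sup>2) * (z\<^sup>2 + t)) (adj2 (F z) ** mderiv F z) = cleared_log_deriv q (of_nat m * \<kappa>) H z"
    if z: "r < norm z" "norm z < 1" for z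
  proof -
    have za: "z \<in> annulus r (1 / r)"
      using z r by (auto simp: annulus_def intro: less_trans[of _ 1])
    note z0 = D(1)[OF za]
    define c where "c = of_nat m * (\<i> / 2 * of_real (- q)) / (Delta_plus (- q) (1 / z))\<^sup>2"
    obtain Q' where Q': "has_mderiv (F_plus (- q) l m) Q' (at (1 / z))"
      "adj2 (F_plus (- q) l m (1 / z)) ** Q' = smul c sigma1"
      using has_mderiv_F_plus[OF D(3)[OF za]] unfolding c_def by blast
    have "adj2 (F_plus (- q) l m (1 / z)) ** smul (- 1 / z\<^sup>2) Q' = smul (- 1 / z\<^sup>2 * c) sigma1"
      by (simp only: smul_mult_right Q'(2) smul_smul)
    \<comment> \<open>The minus signs from the derivative of \<open>1 / z\<close> and from passing
      to \<open>- q\<close> cancel.\<close>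
    moreover have "- 1 / z\<^sup>2 * c = of_nat m * \<kappa> / (z\<^sup>2 + t)"
    proof -
      have "z\<^sup>2 * (Delta_plus (- q) (1 / z))\<^sup>2 = z\<^sup>2 + t"
        using z0 by (simp add: Delta_plus_sq t_def power_divide field_simps)
      from this[symmetric] show ?thesis by (simp only:) (simp add: c_def \<kappa>_def)
    qed
    ultimately have L: "adj2 (F_plus (- q) l m (1 / z)) ** smul (- 1 / z\<^sup>2) Q' = smul (of_nat m * \<kappa> / (z\<^sup>2 + t)) sigma1"
      by simp
    have "has_mderiv H (mderiv H z) (at z)"
      using H z by (intro mhol_has_mderiv[of H "ball 0 1"]) auto
    from log_deriv_mult[OF has_mderiv_inverse[OF Q'(1) z0] this det_F_plus[OF D(3)[OF za]] L]
    obtain G where G: "has_mderiv (\<lambda>z. F_plus (- q) l m (1 / z) ** H z) G (at z)"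
      "adj2 (F_plus (- q) l m (1 / z) ** H z) ** G =
       smul (of_nat m * \<kappa> / (z\<^sup>2 + t)) (adj2 (H z) ** sigma1 ** H z) + adj2 (H z) ** mderiv H z"
      by blast
    have "has_mderiv F G (at z)"
      by (rule has_mderiv_transform_open[OF G(1), of "ball 0 1"]) (use z FH in auto)
    then have "mderiv F z = G" using mF[OF za] has_mderiv_unique by blast
    then have "adj2 (F z) ** mderiv F z =
       smul (of_nat m * \<kappa> / (z\<^sup>2 + t)) (adj2 (H z) ** sigma1 ** H z) + adj2 (H z) ** mderiv H z"
      using G(2) FH[of z] z by simp
    then show ?thesis
      using nz[OF za] by (simp add: cleared_log_deriv_def smul_add flip: t_def)
  qed
  \<comment> \<open>In \<open>w = 1 / z\<close> the polynomial weight is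
    \<open>z ^ 4 * (1 + t * w\<^sup>2) * (w\<^sup>2 + t)\<close>, and the chain rule contributes
    \<open>- 1 / z\<^sup>2\<close>. What is left is \<open>- z\<^sup>2\<close>, the double pole at
    infinity; the coefficient \<open>- of_nat n * \<kappa>\<close> makes up for its sign.\<close>
  have outer: "smul ((1 + t * z\<^sup>2) * (z\<^sup>2 + t)) (adj2 (F z) ** mderiv F z) =
      smul (- z\<^sup>2) (cleared_log_deriv q (- of_nat n * \<kappa>) K (1 / z))"
    if z: "1 < norm z" "norm z < 1 / r" for z
  proof -
    have za: "z \<in> annulus r (1 / r)"
      using z r by (auto simp: annulus_def)
    note z0 = D(1)[OF za]
    obtain P' where P': "has_mderiv (F_plus q s n) P' (at z)"
      "adj2 (F_plus q s n z) ** P' = smul (of_nat n * \<kappa> / (1 + t * z\<^sup>2)) sigma1"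
      using has_mderiv_F_plus[OF D(2)[OF za]] unfolding \<kappa>_def t_def Delta_plus_sq by blast
    have "has_mderiv K (mderiv K (1 / z)) (at (1 / z))"
      using K z z0 by (intro mhol_has_mderiv[of K "ball 0 1"]) (auto simp: norm_divide divide_simps)
    from log_deriv_mult[OF P'(1) has_mderiv_inverse[OF this z0] det_F_plus[OF D(2)[OF za]] P'(2)]
    obtain G where G: "has_mderiv (\<lambda>z. F_plus q s n z ** K (1 / z)) G (at z)"
      "adj2 (F_plus q s n z ** K (1 / z)) ** G =
       smul (of_nat n * \<kappa> / (1 + t * z\<^sup>2)) (adj2 (K (1 / z)) ** sigma1 ** K (1 / z)) +
       adj2 (K (1 / z)) ** smul (- 1 / z\<^sup>2) (mderiv K (1 / z))"
      by blast
    have "has_mderiv F G (at z)"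
      by (rule has_mderiv_transform_open[OF G(1), of "- cball 0 1"]) (use z FK in auto)
    then have "mderiv F z = G" using mF[OF za] has_mderiv_unique by blast
    then have *: "adj2 (F z) ** mderiv F z =
       smul (of_nat n * \<kappa> / (1 + t * z\<^sup>2)) (adj2 (K (1 / z)) ** sigma1 ** K (1 / z)) +
       smul (- 1 / z\<^sup>2) (adj2 (K (1 / z)) ** mderiv K (1 / z))"
      using G(2) FK[of z] z by (simp add: smul_mult_right)
    have 1: "(1 + t * z\<^sup>2) * (z\<^sup>2 + t) * (of_nat n * \<kappa> / (1 + t * z\<^sup>2)) =
        - z\<^sup>2 * ((1 + t * (1 / z)\<^sup>2) * (- of_nat n * \<kappa>))"
      using nz(1)[OF za] z0 by (simp add: field_simps)
    have 2: "(1 + t * z\<^sup>2) * (z\<^sup>2 + t) * (- 1 / z\<^sup>2) =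
        - z\<^sup>2 * ((1 + t * (1 / z)\<^sup>2) * ((1 / z)\<^sup>2 + t))"
      using z0 by (simp add: field_simps)
    show ?thesis
      unfolding * cleared_log_deriv_def t_def[symmetric] smul_add smul_smul 1 2 ..
  qed
  \<comment> \<open>These are the two functions for the matching criterion; the second absorbs the
    minus sign of \<open>outer\<close>.\<close>
  have "(\<lambda>z. cleared_log_deriv q (of_nat m * \<kappa>) H z $ i $ j) holomorphic_on ball 0 1"
    "(\<lambda>z. - cleared_log_deriv q (- of_nat n * \<kappa>) K z $ i $ j) holomorphic_on ball 0 1"
    using mhol_cleared_log_deriv[OF H] mhol_cleared_log_deriv[OF K]
    by (auto simp: mhol_def intro!: holomorphic_intros)
  moreover have "mhol (\<lambda>z. adj2 (F z) ** mderiv F z) (annulus r (1 / r))"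
    using F by (intro mhol_mult mhol_adj2 mhol_mderiv open_annulus) (auto simp: r_def)
  then have "(\<lambda>z. (1 + t * z\<^sup>2) * (z\<^sup>2 + t) * (adj2 (F z) ** mderiv F z) $ i $ j)
      holomorphic_on annulus r (1 / r)"
    by (auto simp: mhol_def intro!: holomorphic_intros)
  ultimately show ?thesis
  proof (rule quadratic_on_circle_of_matching[rotated 3])
    fix z :: complex
    assume "r < norm z" "norm z < 1"
    from arg_cong[OF inner[OF this], of "\<lambda>A. A $ i $ j"]
    show "(1 + t * z\<^sup>2) * (z\<^sup>2 + t) * (adj2 (F z) ** mderiv F z) $ i $ j =
      cleared_log_deriv q (of_nat m * \<kappa>) H z $ i $ j" by simp
  next
    fix z :: complex
    assume "1 < norm z" "norm z < 1 / r"
    from arg_cong[OF outer[OF this], of "\<lambda>A. A $ i $ j"]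
    show "(1 + t * z\<^sup>2) * (z\<^sup>2 + t) * (adj2 (F z) ** mderiv F z) $ i $ j =
      z\<^sup>2 * (- cleared_log_deriv q (- of_nat n * \<kappa>) K (1 / z) $ i $ j)" by simp
  qed (use r in auto)
qed

section \<open>Symmetries of the logarithmic derivative\<close>

text \<open>The derivative along the circle determines the complex derivative, so identities known
  on the circle alone can be differentiated.\<close>

lemma derivs_agree_on_circle:
  assumes "z \<in> circle" "(f has_field_derivative D) (at z)" "(g has_field_derivative D') (at z)"
    and "\<And>w. w \<in> circle \<Longrightarrow> f w = g w"
  shows "D = D'"
proof (rule has_field_derivative_unique[of f D z circle])
  show "(f has_field_derivative D) (at z within circle)"
    using assms(2) by (rule has_field_derivative_at_within)
  have "(g has_field_derivative D') (at z within circle)"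
    using assms(3) by (rule has_field_derivative_at_within)
  then show "(f has_field_derivative D') (at z within circle)"
    by (rule has_field_derivative_transform_within[of _ _ _ _ 1]) (use assms in auto)
qed (use assms(1) at_within_circle_neq_bot in auto)

text \<open>Differentiating the twisting condition gives the parities of the entries,
  \<open>det = 1\<close> gives trace zero, and reality makes \<open>L\<close> anti-Hermitian under
  \<open>cnj z\<close>.\<close>

lemma log_deriv_symmetries:
  assumes der: "\<And>z. z \<in> circle \<Longrightarrow> has_mderiv F (F' z) (at z)"
    and det: "\<And>z. z \<in> circle \<Longrightarrow> det (F z) = 1"
    and re: "\<And>z. z \<in> circle \<Longrightarrow> ctrans (F (cnj z)) = adj2 (F z)"
    and tw: "\<And>z. z \<in> circle \<Longrightarrow> sigma3 ** F z ** sigma3 = F (- z)"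
    and z: "z \<in> circle"
  defines "L \<equiv> \<lambda>z. smul z (adj2 (F z) ** F' z)"
  shows "L (- z) $ 1 $ 1 = L z $ 1 $ 1" "L (- z) $ 1 $ 2 = - L z $ 1 $ 2"
    "L z $ 2 $ 2 = - L z $ 1 $ 1" "cnj (L (cnj z) $ 1 $ 1) = - L z $ 1 $ 1"
    "L z $ 2 $ 1 = - cnj (L (cnj z) $ 1 $ 2)"
proof -
  have d: "((\<lambda>z. F z $ i $ j) has_field_derivative F' z $ i $ j) (at z)" if "z \<in> circle" for z i j
    using der[OF that] by (simp add: has_mderiv_def)
  \<comment> \<open>Conjugating both argument and value preserves complex differentiability, so the
    reality condition can be differentiated as well.\<close>
  have dm: "((\<lambda>z. F (- z) $ i $ j) has_field_derivative - F' (- z) $ i $ j) (at z)"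
    and dc: "((\<lambda>z. cnj (F (cnj z) $ i $ j)) has_field_derivative cnj (F' (cnj z) $ i $ j)) (at z)" for i j
  proof -
    have "((\<lambda>z. F z $ i $ j) has_field_derivative F' (- z) $ i $ j) (at (- z))"
      by (rule d) (use z in auto)
    moreover have "((\<lambda>z::complex. - z) has_field_derivative - 1) (at z)"
      by (auto intro!: derivative_eq_intros)
    ultimately have "((\<lambda>z. F (- z) $ i $ j) has_field_derivative F' (- z) $ i $ j * - 1) (at z)"
      by (rule DERIV_chain2)
    then show "((\<lambda>z. F (- z) $ i $ j) has_field_derivative - F' (- z) $ i $ j) (at z)" by simp
    have "((\<lambda>z. F z $ i $ j) has_field_derivative F' (cnj z) $ i $ j) (at (cnj z))"
      by (rule d) (use z in auto)
    from has_field_derivative_cnj_cnj[OF this]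
    show "((\<lambda>z. cnj (F (cnj z) $ i $ j)) has_field_derivative cnj (F' (cnj z) $ i $ j)) (at z)"
      by (simp add: o_def)
  qed
  have tw': "F (- w) $ 1 $ 1 = F w $ 1 $ 1" "F (- w) $ 1 $ 2 = - F w $ 1 $ 2"
    "F (- w) $ 2 $ 1 = - F w $ 2 $ 1" "F (- w) $ 2 $ 2 = F w $ 2 $ 2" if "w \<in> circle" for w
    using tw[OF that, symmetric] by (simp_all add: matrix_mult_nth2 sigma3_def)
  have re': "cnj (F (cnj w) $ 1 $ 1) = F w $ 2 $ 2" "cnj (F (cnj w) $ 2 $ 1) = - F w $ 1 $ 2"
    "cnj (F (cnj w) $ 1 $ 2) = - F w $ 2 $ 1" "cnj (F (cnj w) $ 2 $ 2) = F w $ 1 $ 1" if "w \<in> circle" for w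
    using re[OF that] by (simp_all add: cmat_eq_iff)
  have tD: "- F' (- z) $ 1 $ 1 = F' z $ 1 $ 1" "- F' (- z) $ 1 $ 2 = - F' z $ 1 $ 2"
    "- F' (- z) $ 2 $ 1 = - F' z $ 2 $ 1" "- F' (- z) $ 2 $ 2 = F' z $ 2 $ 2"
    by (rule derivs_agree_on_circle[OF z dm]; (rule tw')?; auto intro!: derivative_eq_intros d[OF z])+
  have rD: "cnj (F' (cnj z) $ 1 $ 1) = F' z $ 2 $ 2" "cnj (F' (cnj z) $ 2 $ 1) = - F' z $ 1 $ 2"
    "cnj (F' (cnj z) $ 1 $ 2) = - F' z $ 2 $ 1" "cnj (F' (cnj z) $ 2 $ 2) = F' z $ 1 $ 1"
    by (rule derivs_agree_on_circle[OF z dc]; (rule re')?; auto intro!: derivative_eq_intros d[OF z])+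
  \<comment> \<open>The derivative of \<open>det F\<close>, which is constant on the circle; it is
    also the trace of \<open>adj2 (F z) ** F' z\<close>.\<close>
  have dD: "F' z $ 1 $ 1 * F z $ 2 $ 2 + F z $ 1 $ 1 * F' z $ 2 $ 2 -
      (F' z $ 1 $ 2 * F z $ 2 $ 1 + F z $ 1 $ 2 * F' z $ 2 $ 1) = 0"
  proof (rule derivs_agree_on_circle[OF z, of "\<lambda>z. F z $ 1 $ 1 * F z $ 2 $ 2 - F z $ 1 $ 2 * F z $ 2 $ 1" _ "\<lambda>_. 1"])
    show "((\<lambda>z. F z $ 1 $ 1 * F z $ 2 $ 2 - F z $ 1 $ 2 * F z $ 2 $ 1) has_field_derivative
      F' z $ 1 $ 1 * F z $ 2 $ 2 + F z $ 1 $ 1 * F' z $ 2 $ 2 -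
      (F' z $ 1 $ 2 * F z $ 2 $ 1 + F z $ 1 $ 2 * F' z $ 2 $ 1)) (at z)"
      by (rule derivative_eq_intros d[OF z] refl)+ (simp add: algebra_simps)
  qed (use det in \<open>auto simp: det_2\<close>)
  have tD': "F' (- z) $ 1 $ 1 = - F' z $ 1 $ 1" "F' (- z) $ 1 $ 2 = F' z $ 1 $ 2"
    "F' (- z) $ 2 $ 1 = F' z $ 2 $ 1" "F' (- z) $ 2 $ 2 = - F' z $ 2 $ 2"
    using tD by (simp_all add: minus_equation_iff[of "F' (- z) $ _ $ _"])
  show "L (- z) $ 1 $ 1 = L z $ 1 $ 1" "L (- z) $ 1 $ 2 = - L z $ 1 $ 2"
    by (simp_all add: L_def matrix_mult_nth2 tw'[OF z] tD') (simp add: right_diff_distrib)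
  have "L z $ 1 $ 1 + L z $ 2 $ 2 = z * 0"
    unfolding dD[symmetric] by (simp add: L_def matrix_mult_nth2 algebra_simps)
  then show t: "L z $ 2 $ 2 = - L z $ 1 $ 1" by (simp add: eq_neg_iff_add_eq_0 add.commute)
  have "cnj (L (cnj z) $ 1 $ 1) = L z $ 2 $ 2"
    by (simp add: L_def matrix_mult_nth2 re'[OF z] rD algebra_simps)
  with t show "cnj (L (cnj z) $ 1 $ 1) = - L z $ 1 $ 1" by simp
  show "L z $ 2 $ 1 = - cnj (L (cnj z) $ 1 $ 2)"
    by (simp add: L_def matrix_mult_nth2 re'[OF z] rD algebra_simps)
qed

section \<open>From the loop-group data to the shape of the coefficients\<close>

text \<open>The determinant condition turns \<open>matrix_inv\<close> into the adjugate, so that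
  reality has the same form as in \<open>F_plus_reality\<close>.\<close>

lemma LSU2_D:
  assumes "g \<in> LSU2" "z \<in> circle"
  shows "det (g z) = 1" "ctrans (g (cnj z)) = adj2 (g z)" "sigma3 ** g z ** sigma3 = g (- z)"
proof -
  have *: "det (g w) = 1 \<and> g w = matrix_inv (ctrans (g (cnj w))) \<and>
      sigma3 ** g w ** matrix_inv sigma3 = g (- w)" if "w \<in> circle" for w
    using assms(1) that unfolding LSU2_def by blast
  have "cnj z \<in> circle" using assms(2) by simp
  with * have "det (g (cnj z)) = 1" by blast
  then have "matrix_inv (ctrans (g (cnj z))) = adj2 (ctrans (g (cnj z)))"
    by (intro matrix_inv_det1) (simp add: det_ctrans)
  with *[OF assms(2)] have g: "g z = adj2 (ctrans (g (cnj z)))" by metis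
  show "det (g z) = 1" "sigma3 ** g z ** sigma3 = g (- z)"
    using *[OF assms(2)] matrix_inv_sigma3 by metis+
  show "ctrans (g (cnj z)) = adj2 (g z)"
    unfolding g adj2_adj2 ..
qed

theorem theorem3p1:
  fixes q s l :: real and n m :: nat and Vm Vp :: "complex \<Rightarrow> cmat"
  assumes "0 < \<bar>q / 2\<bar>" and "\<bar>q / 2\<bar> < 1"
    and "s \<noteq> l"
    and "Vm \<in> LSU2_minus_star" and "Vp \<in> LSU2_plus"
    and "\<forall>z\<in>circle. matrix_inv (F_plus q s n z) ** G_minus q l m z = Vm z ** matrix_inv (Vp z)"
  shows "\<exists>a b c :: complex. Re a = 0 \<and>
    (\<forall>z\<in>circle. \<exists>D :: cmat.
       (\<forall>i j. ((\<lambda>w. (F_plus q s n w ** Vm w) $ i $ j) has_field_derivative D $ i $ j)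
                (at z within circle)) \<and>
       smul z (matrix_inv (F_plus q s n z ** Vm z) ** D) =
         smul (1 / ((Delta_plus q z)^2 * (Delta_minus q z)^2))
           (mat2 a (b / z + c * z) (- cnj b / z - cnj c * z) (- a)))"
proof -
  define t :: complex where "t = (of_real q / 2)\<^sup>2"
  have Vm: "Vm \<in> LSU2" and Vp: "Vp \<in> LSU2"
    using assms(4,5) by (auto simp: LSU2_minus_star_def LSU2_plus_def)
  obtain H where H: "mhol H (ball 0 1)" "mcont (cball 0 1) H" and HV: "\<forall>z\<in>circle. H z = Vp z"
    using assms(5) unfolding LSU2_plus_def mhol_def mcont_def by blast
  obtain K where K: "mhol K (ball 0 1)" "mcont (cball 0 1) K" and "\<forall>z\<in>circle. K z = Vm (1 / z)"
    using assms(4) unfolding LSU2_minus_star_def ext_minus_def mhol_def mcont_def by blast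
  then have KV: "K (1 / z) = Vm z" if "z \<in> circle" for z
    using that by (simp add: norm_divide)
  have C: "z \<in> annulus \<bar>q / 2\<bar> (1 / \<bar>q / 2\<bar>)" if "z \<in> circle" for z
    using that assms(1,2) by (simp add: annulus_def field_simps)
  note D = annulus_Lambda_disc[OF C]
  \<comment> \<open>The decomposition is multiplied by \<open>F_plus\<close> on the left and by
    \<open>Vp\<close> on the right; both sides are then \<open>F\<close>.\<close>
  have eq: "F_plus q s n z ** Vm z = F_plus (- q) l m (1 / z) ** Vp z" if z: "z \<in> circle" for z
  proof -
    have P: "det (F_plus q s n z) = 1" using D z by (simp add: det_F_plus)
    have V: "det (Vp z) = 1" using LSU2_D(1)[OF Vp z] .
    have "adj2 (F_plus q s n z) ** F_plus (- q) l m (1 / z) = Vm z ** adj2 (Vp z)"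
      using bspec[OF assms(6) z] by (simp add: matrix_inv_det1[OF P] matrix_inv_det1[OF V] G_minus_eq)
    then have "F_plus q s n z ** (adj2 (F_plus q s n z) ** F_plus (- q) l m (1 / z)) ** Vp z =
        F_plus q s n z ** (Vm z ** adj2 (Vp z)) ** Vp z"
      by simp
    moreover have "F_plus q s n z ** (adj2 (F_plus q s n z) ** F_plus (- q) l m (1 / z)) ** Vp z =
        F_plus (- q) l m (1 / z) ** Vp z"
      by (simp add: matrix_mul_assoc adj2_mult_right[OF P])
    moreover have "F_plus q s n z ** (Vm z ** adj2 (Vp z)) ** Vp z = F_plus q s n z ** Vm z"
      by (simp add: adj2_mult_left[OF V] flip: matrix_mul_assoc)
    ultimately show ?thesis by simp
  qed
  then have "F_plus q s n z ** K (1 / z) = F_plus (- q) l m (1 / z) ** H z" if "z \<in> circle" for z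
    using that HV KV by simp
  from analytic_continuation_across_circle[OF assms(1,2) H K this]
  obtain F where F: "mhol F (annulus \<bar>q / 2\<bar> (1 / \<bar>q / 2\<bar>))"
    and FH: "\<And>z. norm z \<le> 1 \<Longrightarrow> F z = F_plus (- q) l m (1 / z) ** H z"
    and FK: "\<And>z. 1 \<le> norm z \<Longrightarrow> F z = F_plus q s n z ** K (1 / z)"
    by blast
  have FV: "F z = F_plus q s n z ** Vm z" if "z \<in> circle" for z
    using FK[of z] KV[OF that] that by simp
  have der: "has_mderiv F (mderiv F z) (at z)" if "z \<in> circle" for z
    by (rule mhol_has_mderiv[OF F open_annulus C[OF that]])
  have det: "det (F z) = 1" if "z \<in> circle" for z
    by (simp add: FV[OF that] det_mul det_F_plus[OF D(2)[OF that]] LSU2_D[OF Vm that])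
  have re: "ctrans (F (cnj z)) = adj2 (F z)" if "z \<in> circle" for z
    using that by (simp add: FV ctrans_mult adj2_mult F_plus_reality[OF D(2)] LSU2_D(2)[OF Vm])
  have tw: "sigma3 ** F z ** sigma3 = F (- z)" if "z \<in> circle" for z
  proof -
    have "sigma3 ** sigma3 = mat 1"
      by (simp add: cmat_eq_iff matrix_mult_nth2 sigma3_def)
    then have "sigma3 ** F z ** sigma3 = sigma3 ** F_plus q s n z ** (sigma3 ** sigma3) ** Vm z ** sigma3"
      by (simp add: FV[OF that] matrix_mul_assoc)
    also have "\<dots> = (sigma3 ** F_plus q s n z ** sigma3) ** (sigma3 ** Vm z ** sigma3)"
      by (simp only: matrix_mul_assoc)
    finally show ?thesis
      using FV[of "- z"] that by (simp add: F_plus_twisted LSU2_D(3)[OF Vm])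
  qed
  define L where "L = (\<lambda>z. smul z (adj2 (F z) ** mderiv F z))"
  define p where "p z = (Delta_plus q z)\<^sup>2 * (Delta_minus q z)\<^sup>2" for z
  have sym: "L (- z) $ 1 $ 1 = L z $ 1 $ 1" "L (- z) $ 1 $ 2 = - L z $ 1 $ 2"
    "L z $ 2 $ 2 = - L z $ 1 $ 1" "cnj (L (cnj z) $ 1 $ 1) = - L z $ 1 $ 1"
    "L z $ 2 $ 1 = - cnj (L (cnj z) $ 1 $ 2)" if "z \<in> circle" for z
    unfolding L_def by (rule log_deriv_symmetries[of F "mderiv F", OF der det re tw that]; assumption)+
  have p: "p z = (1 + t * z\<^sup>2) * (z\<^sup>2 + t) / z\<^sup>2" "p z \<noteq> 0" if "z \<in> circle" for z
  proof -
    show "p z \<noteq> 0"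
      using Delta_plus_nz[OF D(2)[OF that]] Delta_plus_nz[of "1 / z" "- q"] D(3)[OF that]
      by (simp add: p_def Delta_minus_eq)
    show "p z = (1 + t * z\<^sup>2) * (z\<^sup>2 + t) / z\<^sup>2"
      using D(1)[OF that] by (simp add: p_def Delta_minus_eq Delta_plus_sq t_def power_divide field_simps)
  qed
  \<comment> \<open>\<open>p\<close> is even and symmetric under conjugation, so multiplying by it
    preserves the parity and reality of \<open>L\<close>.\<close>
  have pm: "p (- z) = p z" if "z \<in> circle" for z
    using that by (simp add: p)
  have pc: "cnj (p (cnj z)) = p z" if "z \<in> circle" for z
    using that by (simp add: p t_def)
  \<comment> \<open>\<open>p\<close> contains \<open>1 / z\<^sup>2\<close> and \<open>L\<close> a
    factor \<open>z\<close>, so the quadratic polynomial gets divided by \<open>z\<close>.\<close>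
  have quad: "\<exists>\<alpha> \<beta> \<gamma>. \<forall>z\<in>circle. p z * L z $ i $ j = \<alpha> / z + \<beta> + \<gamma> * z" for i j
  proof -
    from log_deriv_quadratic[OF assms(1,2) H(1) K(1) F FH FK, of i j, folded t_def]
    obtain \<alpha> \<beta> \<gamma> where *: "\<forall>z\<in>circle. (1 + t * z\<^sup>2) * (z\<^sup>2 + t) * (adj2 (F z) ** mderiv F z) $ i $ j
        = \<alpha> + \<beta> * z + \<gamma> * z\<^sup>2"
      by auto
    have "p z * L z $ i $ j = \<alpha> / z + \<beta> + \<gamma> * z" if "z \<in> circle" for z
    proof -
      have "p z * L z $ i $ j = ((1 + t * z\<^sup>2) * (z\<^sup>2 + t) * (adj2 (F z) ** mderiv F z) $ i $ j) / z"
        using D(1)[OF that] by (simp add: p(1)[OF that] L_def power2_eq_square)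
      also have "\<dots> = (\<alpha> + \<beta> * z + \<gamma> * z\<^sup>2) / z" using * that by simp
      finally show ?thesis
        using D(1)[OF that] by (simp add: add_divide_distrib power2_eq_square)
    qed
    then show ?thesis by blast
  qed
  obtain a1 a a2 where a: "\<And>z. z \<in> circle \<Longrightarrow> p z * L z $ 1 $ 1 = a1 / z + a + a2 * z"
    using quad[of 1 1] by blast
  obtain b b0 c where b: "\<And>z. z \<in> circle \<Longrightarrow> p z * L z $ 1 $ 2 = b / z + b0 + c * z"
    using quad[of 1 2] by blast
  \<comment> \<open>The diagonal entry is even, so its odd Laurent coefficients vanish.\<close>
  have "(2 * a1) / z + 0 + (2 * a2) * z = 0" if "z \<in> circle" for z
  proof -
    have "a1 / z + a + a2 * z = - (a1 / z) + a - a2 * z"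
      using a[OF that] a[of "- z"] that by (simp add: pm sym(1))
    then have "2 * (a1 / z) + 2 * (a2 * z) = 0" by algebra
    then show ?thesis by (simp add: mult.assoc)
  qed
  note a12 = laurent_coeffs_zero[OF this]
  \<comment> \<open>The off-diagonal entry is odd, which kills its constant term.\<close>
  have "0 / z + 2 * b0 + 0 * z = 0" if "z \<in> circle" for z
  proof -
    have "- (b / z + b0 + c * z) = - (b / z) + b0 - c * z"
      using b[OF that] b[of "- z"] that by (simp add: pm sym(2))
    then have "2 * b0 = 0" by algebra
    then show ?thesis by simp
  qed
  note b0 = laurent_coeffs_zero[OF this]
  have L11: "p z * L z $ 1 $ 1 = a" if "z \<in> circle" for z
    using a[OF that] a12 by simp
  have L12: "p z * L z $ 1 $ 2 = b / z + c * z" if "z \<in> circle" for z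
    using b[OF that] b0 by simp
  \<comment> \<open>Reality relates this entry to the conjugate of the other off-diagonal one at
    \<open>cnj z\<close>; conjugating its Laurent polynomial there restores \<open>z\<close> and
    conjugates only the coefficients.\<close>
  have L21: "p z * L z $ 2 $ 1 = - cnj b / z - cnj c * z" if "z \<in> circle" for z
  proof -
    have "cnj (p (cnj z) * L (cnj z) $ 1 $ 2) = cnj (b / cnj z + c * cnj z)"
      using that by (subst L12) auto
    then show ?thesis
      using that pc[OF that] sym(5)[OF that] by simp
  qed
  have L22: "p z * L z $ 2 $ 2 = - a" if "z \<in> circle" for z
    using L11[OF that] sym(3)[OF that] by simp
  \<comment> \<open>The constant is read off at \<open>z = 1\<close>, which conjugation
    fixes.\<close>
  have "cnj a = - a"
    using L11[of 1] sym(4)[of 1] pc[of 1] by (metis complex_cnj_mult complex_cnj_one mult_minus_right norm_one mem_sphere_0)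
  then have "Re a = 0" by (simp add: complex_eq_iff)
  moreover have "\<exists>D :: cmat.
       (\<forall>i j. ((\<lambda>w. (F_plus q s n w ** Vm w) $ i $ j) has_field_derivative D $ i $ j)
                (at z within circle)) \<and>
       smul z (matrix_inv (F_plus q s n z ** Vm z) ** D) =
         smul (1 / ((Delta_plus q z)^2 * (Delta_minus q z)^2))
           (mat2 a (b / z + c * z) (- cnj b / z - cnj c * z) (- a))" if z: "z \<in> circle" for z
  proof (intro exI conjI allI)
    fix i j
    \<comment> \<open>The witness for \<open>D\<close> is \<open>mderiv F z\<close>.
      \<open>F\<close> agrees with the product on the circle, which is enough for the derivative
      within the circle.\<close>
    have "((\<lambda>w. F w $ i $ j) has_field_derivative mderiv F z $ i $ j) (at z within circle)"
      using der[OF z] unfolding has_mderiv_def by (blast intro: has_field_derivative_at_within)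
    then show "((\<lambda>w. (F_plus q s n w ** Vm w) $ i $ j) has_field_derivative mderiv F z $ i $ j) (at z within circle)"
      by (rule has_field_derivative_transform_within[of _ _ _ _ 1]) (use z FV in auto)
  next
    have "smul z (matrix_inv (F_plus q s n z ** Vm z) ** mderiv F z) = L z"
      by (simp add: L_def matrix_inv_det1[OF det[OF z]] flip: FV[OF z])
    also have "L z = smul (1 / p z) (mat2 a (b / z + c * z) (- cnj b / z - cnj c * z) (- a))"
    proof -
      have "x = 1 / p z * y" if "p z * x = y" for x y
        using p(2)[OF z] that by auto
      then show ?thesis
        by (simp only: cmat_eq_iff smul_nth mat2_nth) (intro conjI; blast intro: L11 L12 L21 L22 z)
    qed
    finally show "smul z (matrix_inv (F_plus q s n z ** Vm z) ** mderiv F z) =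
         smul (1 / ((Delta_plus q z)^2 * (Delta_minus q z)^2))
           (mat2 a (b / z + c * z) (- cnj b / z - cnj c * z) (- a))"
      by (simp add: p_def)
  qed
  ultimately show ?thesis by blast
qed

end
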